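(* For any distinct $\lambda,\mu\in\overline{\mathbb{D}}\setminus\{0\}$, the Bloch constant $B(\lambda,\mu)$ for the class $\mathcal{M}_1(\lambda,\mu)$ is infinite, i.e. $B(\lambda,\mu)=\infty$.
   Context: Let $\mathbb{D}=\{z\in\mathbb{C}:|z|<1\}$. For distinct $\lambda,\mu\in\overline{\mathbb{D}}\setminus\{0\}$, $\mathcal{M}_1(\lambda,\mu)$ is the class of all meromorphic functions $f$ in $\mathbb{D}$ having two simple poles, at $z=\lambda$ and $z=\mu$, analytic at all other points of $\mathbb{D}$, and normalized by $f'(0)=1$. If $\lambda$ (or $\mu$) lies on $\partial\mathbb{D}$, having a simple pole there means that near that point $\lambda$ one has $f(z)=h(z)/(z-\lambda)$ with $h$ analytic at $\lambda$ and $h(\lambda)\neq0$ (similarly for $\mu$). For $f\in\mathcal{M}_1(\lambda,\mu)$, $B_f(\lambda,\mu)$ is the radius of the largest schlicht disk contained in $f(\mathbb{D})$, i.e. the supremum in $[0,\infty]$ of the radii of schlicht disks, where a schlicht disk is an open Euclidean disk $\Delta\subset\mathbb{C}$ for which there is a subdomain $U\subset\mathbb{D}$ such that $f$ is univalent on $U$ and $f(U)=\Delta$. The Bloch constant of the class is $B(\lambda,\mu)=\inf\{B_f(\lambda,\mu):f\in\mathcal{M}_1(\lambda,\mu)\}$. *)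

theory Defs
  imports "HOL-Complex_Analysis.Complex_Analysis"
begin

abbreviation unit_disk :: "complex set" where
  "unit_disk \<equiv> ball 0 1"

text \<open>
  At a point of the open disk a simple pole is meant in the usual sense. At a boundary point,
  \<^term>\<open>f\<close> is only considered inside the disk, so the local representation is required on the
  trace of a neighbourhood on the disk, while \<^term>\<open>h\<close> is analytic in a full neighbourhood.
\<close>

definition simple_pole_in_closed_disk :: "(complex \<Rightarrow> complex) \<Rightarrow> complex \<Rightarrow> bool" where
  "simple_pole_in_closed_disk f a \<longleftrightarrow>
     (if a \<in> unit_disk then is_pole f a \<and> zorder f a = -1
      else \<exists>h. h analytic_on {a} \<and> h a \<noteq> 0 \<and>
               (\<forall>\<^sub>F z in at a within unit_disk. f z = h z / (z - a)))"

text \<open>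
  Meromorphic functions are represented by total functions on the complex numbers; the values at
  the poles and outside the open unit disk are irrelevant.
\<close>

definition M1 :: "complex \<Rightarrow> complex \<Rightarrow> (complex \<Rightarrow> complex) set" where
  "M1 p q = {f. f meromorphic_on unit_disk \<and> f analytic_on (unit_disk - {p, q}) \<and>
                simple_pole_in_closed_disk f p \<and> simple_pole_in_closed_disk f q \<and>
                deriv f 0 = 1}"

text \<open>
  Univalent means holomorphic and injective. Holomorphy keeps \<^term>\<open>U\<close> away from the
  poles, at which \<^term>\<open>f\<close> has a meaningless finite value.
\<close>

definition schlicht_disk :: "(complex \<Rightarrow> complex) \<Rightarrow> complex \<Rightarrow> real \<Rightarrow> bool" where
  "schlicht_disk f c r \<longleftrightarrow> 0 < r \<and>
     (\<exists>U. U \<subseteq> unit_disk \<and> open U \<and> connected U \<and> U \<noteq> {} \<and>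
          f holomorphic_on U \<and> inj_on f U \<and> f ` U = ball c r)"

definition bloch_radius :: "(complex \<Rightarrow> complex) \<Rightarrow> ennreal" where
  "bloch_radius f = Sup {ennreal r | c r. schlicht_disk f c r}"

definition bloch_constant :: "complex \<Rightarrow> complex \<Rightarrow> ennreal" where
  "bloch_constant p q = (INF f \<in> M1 p q. bloch_radius f)"

end

theory Submission
  imports Defs
begin

text \<open>
  A single simple pole already forces arbitrarily large schlicht disks. Near the pole \<open>a\<close> a function
  \<open>f\<close> of the class is \<open>h z / (z - a)\<close> with \<open>h\<close> analytic, that is, \<open>h a / (z - a) + k z\<close> with
  \<open>k\<close> analytic. In the coordinate \<open>w = 1 / (z - a)\<close>, which sends the pole to infinity, this reads
  \<open>h a * w + k (a + 1 / w)\<close>: a nonconstant linear map plus a bounded term whose Lipschitz constant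
  tends to \<open>0\<close> as \<open>w\<close> tends to infinity.

  The unit disk has enough room near \<open>a\<close>, even when \<open>a\<close> lies on its boundary: since
  \<open>\<bar>a\<bar> \<le> 1\<close>, every \<open>w\<close> with \<open>Re (a * w) < - 1 / 2\<close> satisfies \<open>\<bar>a + 1 / w\<bar> < 1\<close>. As
  \<open>a \<noteq> 0\<close>, these \<open>w\<close> form a half plane, and deep inside it there are disks of every radius on which
  the perturbation does no harm. The lemma \<open>ball_subset_image_near_linear\<close> then exhibits a disk of
  any prescribed radius as a univalent image. Its injectivity comes from the Lipschitz bound, its
  surjectivity from Brouwer's fixed point theorem.
\<close>

text \<open>
  The zorder formalism at interior poles gives the same factorization that is the definition of a
  pole at a boundary point, so both kinds of poles can be treated alike from here on.
\<close>

lemma simple_pole_in_closed_disk_local_form: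
  assumes "f meromorphic_on unit_disk" and "simple_pole_in_closed_disk f a"
  obtains h where "h analytic_on {a}" "h a \<noteq> 0"
    "\<forall>\<^sub>F z in at a within unit_disk. f z = h z / (z - a)"
proof (cases "a \<in> unit_disk")
  case False
  then show thesis using assms that unfolding simple_pole_in_closed_disk_def by auto
next
  case True
  have "isolated_singularity_at f a"
    using assms(1) True unfolding meromorphic_on_altdef by blast
  then obtain d where d: "0 < d" "f holomorphic_on ball a d - {a}"
    unfolding isolated_singularity_at_def using analytic_imp_holomorphic by blast
  have pole: "is_pole f a" "zorder f a = -1"
    using assms(2) True unfolding simple_pole_in_closed_disk_def by auto
  define h where "h = zor_poly f a"
  from zorder_exist_pole[OF d(2) open_ball _ pole(1)] d(1) pole(2)
  obtain r where r: "0 < r" "h holomorphic_on cball a r" "h a \<noteq> 0"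
      "\<And>z. z \<in> cball a r - {a} \<Longrightarrow> f z = h z / (z - a)"
    unfolding h_def by auto
  have "h analytic_on {a}"
    using r(1) holomorphic_on_subset[OF r(2) ball_subset_cball] by (auto simp: analytic_on_def)
  moreover have "\<forall>\<^sub>F z in at a within unit_disk. f z = h z / (z - a)"
    unfolding eventually_at using r(1,4) by (intro exI[of _ r]) (auto simp: dist_commute)
  ultimately show thesis using that r(3) by blast
qed

text \<open>
  Splitting off the principal part leaves the difference quotient of \<^term>\<open>h\<close> at \<^term>\<open>a\<close>, whose
  singularity is removable. A Lipschitz bound is recorded because it serves twice: it makes the
  regular part bounded, and it makes its Lipschitz constant small far out in the coordinate
  \<open>w = 1 / (z - a)\<close>.
\<close>

lemma simple_pole_principal_part:
  fixes h :: "complex \<Rightarrow> complex"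
  assumes "h analytic_on {a}"
  obtains e L k where "0 < e" "0 \<le> L" "L-lipschitz_on (cball a e) k" "h holomorphic_on cball a e"
    "\<forall>z\<in>cball a e - {a}. h z / (z - a) = h a * inverse (z - a) + k z"
proof -
  obtain d where d: "0 < d" "h holomorphic_on ball a d"
    using assms by (auto simp: analytic_on_def)
  define k where "k z = (if z = a then deriv h a else (h z - h a) / (z - a))" for z
  have k: "k holomorphic_on ball a d"
    unfolding k_def using pole_lemma[OF d(2), of a] d(1) by simp
  define e where "e = d / 2"
  have e: "0 < e" "cball a e \<subseteq> ball a d" using d(1) by (auto simp: e_def)
  have "continuous_on (cball a e) (deriv k)"
    by (intro holomorphic_on_imp_continuous_on holomorphic_on_subset[OF holomorphic_deriv[OF k open_ball] e(2)])
  then have "bounded (deriv k ` cball a e)"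
    by (intro compact_imp_bounded compact_continuous_image) auto
  then obtain L where L: "0 < L" "\<And>z. z \<in> cball a e \<Longrightarrow> norm (deriv k z) \<le> L"
    by (auto simp: bounded_pos)
  have "norm (k x - k y) \<le> L * norm (x - y)" if "x \<in> cball a e" "y \<in> cball a e" for x y
  proof (rule field_differentiable_bound[of "cball a e" k "deriv k" L])
    fix z assume "z \<in> cball a e"
    then show "(k has_field_derivative deriv k z) (at z within cball a e)"
      using e(2) k holomorphic_derivI by blast
  qed (use L that in auto)
  then have "L-lipschitz_on (cball a e) k"
    using L(1) by (auto intro!: lipschitz_onI simp: dist_norm)
  moreover have "h z / (z - a) = h a * inverse (z - a) + k z" if "z \<noteq> a" for z
    using that by (simp add: k_def divide_inverse algebra_simps)
  ultimately show thesis
    by (intro that[OF e(1) less_imp_le[OF L(1)] _ holomorphic_on_subset[OF d(2) e(2)]]) auto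
qed

text \<open>
  The equation \<open>a * w + g w = y\<close> asks for a fixed point of \<open>w \<mapsto> (y - g w) / a\<close>. For \<open>y\<close> within
  \<open>r\<close> of \<open>a * w0\<close> this map sends \<open>W\<close> into the disk of radius \<open>(r + M) / \<bar>a\<bar>\<close> about \<open>w0\<close>, whence
  the size of the disk required inside \<open>W\<close>. Since \<open>l < \<bar>a\<bar>\<close>, the map \<open>w \<mapsto> a * w + g w\<close> expands distances
  by a positive factor on \<open>W\<close>; so it is injective, and its inverse is continuous, which makes the
  preimage of the disk connected.
\<close>

lemma ball_subset_image_near_linear:
  fixes a :: complex and g :: "complex \<Rightarrow> complex"
  assumes a: "a \<noteq> 0" and "open W" and lip: "l-lipschitz_on W g" and "l < norm a"
    and M: "\<And>w. w \<in> W \<Longrightarrow> norm (g w) \<le> M" and "0 \<le> M" and r: "0 < r"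
    and sub: "cball w0 ((r + M) / norm a) \<subseteq> W"
  obtains V where "V \<subseteq> W" "open V" "connected V" "V \<noteq> {}"
    "inj_on (\<lambda>w. a * w + g w) V" "(\<lambda>w. a * w + g w) ` V = ball (a * w0) r"
proof -
  define G where "G w = a * w + g w" for w
  define V where "V = W \<inter> G -` ball (a * w0) r"
  define R where "R = (r + M) / norm a"
  define m where "m = norm a - l"
  have m: "0 < m" using assms(4) by (simp add: m_def)
  have contg: "continuous_on W g" using lip by (rule lipschitz_on_continuous_on)
  have expand: "m * norm (x - y) \<le> norm (G x - G y)" if "x \<in> W" "y \<in> W" for x y
  proof -
    have "norm (g x - g y) \<le> l * norm (x - y)"
      using lipschitz_onD[OF lip that] by (simp add: dist_norm)
    moreover have "norm (a * (x - y)) \<le> norm (G x - G y) + norm (g x - g y)"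
      using norm_triangle_ineq4[of "G x - G y" "g x - g y"] by (simp add: G_def algebra_simps)
    ultimately show ?thesis
      unfolding norm_mult m_def left_diff_distrib by linarith
  qed
  have inj: "inj_on G W"
  proof (rule inj_onI)
    fix x y assume "x \<in> W" "y \<in> W" "G x = G y"
    then have "m * norm (x - y) \<le> 0" using expand[of x y] by simp
    then show "x = y" using m by (simp add: mult_le_0_iff)
  qed
  have image: "G ` V = ball (a * w0) r"
  proof (intro equalityI subsetI)
    fix y assume y: "y \<in> ball (a * w0) r"
    define T where "T w = (y - g w) / a" for w
    have cont: "continuous_on (cball w0 R) T"
      unfolding T_def using a continuous_on_subset[OF contg] sub
      by (intro continuous_intros) (auto simp: R_def)
    have T: "T w \<in> cball w0 R" if "w \<in> cball w0 R" for w
    proof -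
      have "w \<in> W" using that sub by (auto simp: R_def)
      then have "norm (a * w0 - y + g w) \<le> r + M"
        using y M[of w] norm_triangle_ineq[of "a * w0 - y" "g w"]
        by (simp add: dist_norm)
      moreover have "w0 - T w = (a * w0 - y + g w) / a"
        using a by (simp add: T_def field_simps)
      ultimately show ?thesis
        using a by (simp add: dist_norm R_def norm_divide divide_right_mono)
    qed
    have "0 < R" using r a \<open>0 \<le> M\<close> by (simp add: R_def)
    obtain w where w: "w \<in> cball w0 R" "T w = w"
      using brouwer_ball[OF \<open>0 < R\<close> cont] T by blast
    then have "G w = y" using a by (simp add: T_def G_def field_simps)
    then show "y \<in> G ` V" using w(1) sub y by (auto simp: V_def R_def)
  qed (auto simp: V_def)
  have VW: "V \<subseteq> W" by (auto simp: V_def)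
  have injV: "inj_on G V" using inj VW inj_on_subset by blast
  have "(1/m)-lipschitz_on (ball (a * w0) r) (inv_into V G)"
  proof (rule lipschitz_onI)
    fix x y assume "x \<in> ball (a * w0) r" "y \<in> ball (a * w0) r"
    then have xy: "x \<in> G ` V" "y \<in> G ` V" using image by auto
    then show "dist (inv_into V G x) (inv_into V G y) \<le> 1 / m * dist x y"
      using expand[of "inv_into V G x" "inv_into V G y"] VW m inv_into_into[OF xy(1)] inv_into_into[OF xy(2)]
      by (auto simp: f_inv_into_f[OF xy(1)] f_inv_into_f[OF xy(2)] dist_norm field_simps)
  qed (use m in simp)
  then have "connected (inv_into V G ` ball (a * w0) r)"
    by (intro connected_continuous_image lipschitz_on_continuous_on) auto
  then have conn: "connected V"
    using injV by (simp flip: image add: inv_into_image_cancel)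
  have contG: "continuous_on W G" unfolding G_def by (intro continuous_intros contg)
  then have "open V" unfolding V_def by (intro continuous_open_preimage assms(2)) auto
  moreover have "V \<noteq> {}" using image r by (metis image_empty ball_eq_empty not_le)
  ultimately show thesis
    using that VW conn injV image unfolding G_def by blast
qed

text \<open>
  The half plane \<open>W\<close> below lives in the coordinate \<open>w = 1 / (z - a)\<close>, and the threshold \<open>T\<close> is a sum
  so that each summand can take care of one smallness condition. The bound \<open>M\<close> on the perturbation
  is fixed before the radius \<open>r\<close> is chosen, and only the centre \<open>w0\<close> has to move with \<open>r\<close>.
\<close>

lemma bloch_radius_infinite:
  assumes a: "a \<noteq> 0" "norm a \<le> 1" and mero: "f meromorphic_on unit_disk"
    and pole: "simple_pole_in_closed_disk f a"
  shows "bloch_radius f = \<infinity>"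
proof -
  obtain h where h: "h analytic_on {a}" "h a \<noteq> 0"
      and ev: "\<forall>\<^sub>F z in at a within unit_disk. f z = h z / (z - a)"
    using simple_pole_in_closed_disk_local_form[OF mero pole] .
  obtain e L k where e: "0 < e" and L: "0 \<le> L" "L-lipschitz_on (cball a e) k"
      and hol: "h holomorphic_on cball a e"
      and k: "\<forall>z\<in>cball a e - {a}. h z / (z - a) = h a * inverse (z - a) + k z"
    using simple_pole_principal_part[OF h(1)] .
  obtain d where d: "0 < d"
      "\<And>z. \<lbrakk>z \<in> unit_disk; z \<noteq> a; dist z a < d\<rbrakk> \<Longrightarrow> f z = h z / (z - a)"
    using ev by (auto simp: eventually_at)
  \<comment> \<open>On \<open>\<bar>w\<bar> > T\<close>, the terms \<open>1 / e\<close> and \<open>1 / d\<close> keep \<open>a + 1 / w\<close> within the two given neighbourhoods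
     of \<open>a\<close>, and the last one makes \<open>L / T\<close> smaller than the slope \<open>\<bar>h a\<bar>\<close>.\<close>
  define T where "T = 1 + 1 / e + 1 / d + L / norm (h a)"
  define W where "W = {w. Re (a * w) < - T}"
  define z where "z w = a + inverse w" for w
  have T: "1 \<le> T" "1 / e < T" "1 / d < T" "L < T * norm (h a)"
  proof -
    have "0 < 1 / e" "0 < 1 / d" "0 \<le> L / norm (h a)" using e d(1) L(1) by auto
    then show "1 \<le> T" "1 / e < T" "1 / d < T" unfolding T_def by linarith+
    have "L / norm (h a) < T" using e d(1) by (simp add: T_def add_pos_pos)
    then show "L < T * norm (h a)" using h(2) by (simp add: divide_less_eq)
  qed
  have norm_W: "T < norm w" if "w \<in> W" for w
  proof -
    have "T < norm (a * w)" using that abs_Re_le_cmod[of "a * w"] by (auto simp: W_def)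
    also have "\<dots> \<le> norm w" using a(2) by (simp add: norm_mult mult_left_le_one_le)
    finally show ?thesis .
  qed
  have W0: "w \<noteq> 0" if "w \<in> W" for w using norm_W[OF that] T(1) by auto
  have z_disk: "z w \<in> unit_disk" if "w \<in> W" for w
  proof -
    \<comment> \<open>This expansion turns \<open>Re (a * w) < - 1 / 2\<close> into membership in the disk.\<close>
    have "(norm (a * w + 1))\<^sup>2 = (norm (a * w))\<^sup>2 + (2 * Re (a * w) + 1)"
      unfolding cmod_power2 by (simp add: power2_eq_square algebra_simps)
    also have "\<dots> < (norm (a * w))\<^sup>2" using that T(1) by (simp add: W_def)
    also have "\<dots> \<le> (norm w)\<^sup>2"
      using a(2) by (intro power_mono) (auto simp: norm_mult mult_left_le_one_le)
    finally have "norm (a * w + 1) < norm w" by (rule power2_less_imp_less) simp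
    moreover have "z w = (a * w + 1) / w" using W0[OF that] by (simp add: z_def field_simps)
    ultimately show ?thesis using W0[OF that] by (simp add: norm_divide divide_less_eq)
  qed
  have z_near: "dist a (z w) < e" "dist (z w) a < d" "z w \<noteq> a" if "w \<in> W" for w
  proof -
    have w: "1 / e < norm w" "1 / d < norm w" "0 < norm w" using norm_W[OF that] T by auto
    have dist: "dist a (z w) = 1 / norm w"
      by (simp add: z_def dist_norm norm_divide inverse_eq_divide)
    show "dist a (z w) < e" unfolding dist using w(1,3) e by (simp add: field_simps)
    show "dist (z w) a < d" unfolding dist_commute[of "z w"] dist using w(2,3) d(1) by (simp add: field_simps)
    show "z w \<noteq> a" using W0[OF that] by (simp add: z_def)
  qed
  have lip: "(L / T)-lipschitz_on W (\<lambda>w. k (z w))"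
  proof (rule lipschitz_onI)
    fix v w assume vw: "v \<in> W" "w \<in> W"
    \<comment> \<open>Inversion contracts by \<open>1 / (\<bar>v\<bar> * \<bar>w\<bar>)\<close>; since \<open>T \<ge> 1\<close>, the weaker factor \<open>1 / T\<close> suffices.\<close>
    have "z v - z w = (w - v) / (v * w)"
      using vw[THEN W0] by (simp add: z_def field_simps)
    then have "dist (z v) (z w) = dist v w / (norm v * norm w)"
      by (simp add: dist_norm norm_divide norm_mult norm_minus_commute)
    also have "\<dots> \<le> dist v w / (T * 1)"
      using vw[THEN norm_W] T(1) by (intro divide_left_mono mult_mono mult_pos_pos) auto
    finally have "L * dist (z v) (z w) \<le> L * (dist v w / (T * 1))"
      by (rule mult_left_mono[OF _ L(1)])
    then have "L * dist (z v) (z w) \<le> L / T * dist v w" by simp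
    moreover have "dist (k (z v)) (k (z w)) \<le> L * dist (z v) (z w)"
      using vw[THEN z_near(1)] by (intro lipschitz_onD[OF L(2)]) auto
    ultimately show "dist (k (z v)) (k (z w)) \<le> L / T * dist v w" by linarith
  qed (use L T in simp)
  define M where "M = norm (k a) + L * e"
  have "0 \<le> M" using L(1) e by (simp add: M_def)
  have M: "norm (k (z w)) \<le> M" if "w \<in> W" for w
  proof -
    have "dist (k (z w)) (k a) \<le> L * dist (z w) a"
      using z_near(1)[OF that] e by (intro lipschitz_onD[OF L(2)]) auto
    also have "\<dots> \<le> L * e"
      using z_near(1)[OF that] L(1) by (intro mult_left_mono) (auto simp: dist_commute)
    finally show ?thesis
      using norm_triangle_ineq2[of "k (z w)" "k a"] by (simp add: M_def dist_norm)
  qed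
  have schlicht: "\<exists>c. schlicht_disk f c r" if r: "0 < r" for r
  proof -
    define R where "R = (r + M) / norm (h a)"
    \<comment> \<open>The centre satisfies \<open>Re (a * w0) = - (T + R + 1)\<close>, so a disk of radius \<open>R\<close> about it stays in \<open>W\<close>.\<close>
    define w0 where "w0 = - of_real (T + R + 1) / a"
    have sub: "cball w0 R \<subseteq> W"
    proof
      fix w assume "w \<in> cball w0 R"
      then have "norm (a * (w - w0)) \<le> R"
        using mult_left_le_one_le[of "norm (w - w0)" "norm a"] a(2)
        by (simp add: norm_mult dist_norm norm_minus_commute)
      moreover have "a * w0 = - of_real (T + R + 1)" using a(1) by (simp add: w0_def)
      then have "Re (a * w) = Re (a * (w - w0)) - (T + R + 1)"
        by (simp add: right_diff_distrib del: times_complex.simps)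
      ultimately show "w \<in> W"
        using abs_Re_le_cmod[of "a * (w - w0)"] by (simp add: W_def)
    qed
    have "open W" unfolding W_def by (intro open_Collect_less continuous_intros)
    have "L / T < norm (h a)" using T by (simp add: field_simps)
    obtain V where V: "V \<subseteq> W" "open V" "connected V" "V \<noteq> {}"
      "inj_on (\<lambda>w. h a * w + k (z w)) V"
      "(\<lambda>w. h a * w + k (z w)) ` V = ball (h a * w0) r"
      using ball_subset_image_near_linear[OF h(2) \<open>open W\<close> lip \<open>L / T < norm (h a)\<close> M
          \<open>0 \<le> M\<close> r sub[unfolded R_def]] .
    have fz: "f (z w) = h a * w + k (z w)" if "w \<in> V" for w
    proof -
      have "w \<in> W" using that V(1) by auto
      note z = z_near[OF this]
      have "f (z w) = h (z w) / (z w - a)" by (rule d(2)[OF z_disk[OF \<open>w \<in> W\<close>] z(3,2)])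
      also have "\<dots> = h a * inverse (z w - a) + k (z w)" using z(1,3) by (intro k[rule_format]) auto
      also have "inverse (z w - a) = w" by (simp add: z_def)
      finally show ?thesis .
    qed
    have zhol: "z holomorphic_on V"
      unfolding z_def using W0 V(1) by (intro holomorphic_intros) auto
    have zinj: "inj_on z V" by (auto simp: inj_on_def z_def)
    have "z ` V \<subseteq> cball a e - {a}"
    proof (intro image_subsetI)
      fix w assume "w \<in> V"
      then have "w \<in> W" using V(1) by auto
      from z_near[OF this] show "z w \<in> cball a e - {a}" by simp
    qed
    then have "(\<lambda>u. h u / (u - a)) holomorphic_on z ` V"
      by (intro holomorphic_intros holomorphic_on_subset[OF hol]) auto
    then have "f holomorphic_on z ` V"
    proof (rule holomorphic_transform)
      fix u assume "u \<in> z ` V"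
      then obtain w where w: "u = z w" "w \<in> W" using V(1) by blast
      show "h u / (u - a) = f u"
        unfolding w(1) by (rule d(2)[OF z_disk z_near(3,2), symmetric]) (rule w(2))+
    qed
    moreover have "inj_on (f \<circ> z) V"
      using V(5) fz by (simp cong: inj_on_cong)
    then have "inj_on f (z ` V)" by (rule inj_on_imageI)
    moreover have "f ` z ` V = ball (h a * w0) r"
      using fz by (simp add: image_image flip: V(6) cong: image_cong_simp)
    moreover have "open (z ` V)" by (rule open_mapping_thm3[OF zhol V(2) zinj])
    moreover have "connected (z ` V)"
      using zhol V(3) by (intro connected_continuous_image holomorphic_on_imp_continuous_on)
    moreover have "z ` V \<subseteq> unit_disk" using z_disk V(1) by auto
    ultimately have "schlicht_disk f (h a * w0) r"
      unfolding schlicht_disk_def using r V(4) by blast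
    then show ?thesis ..
  qed
  have lower: "ennreal r \<le> bloch_radius f" if "0 < r" for r
    unfolding bloch_radius_def using schlicht[OF that] by (intro Sup_upper) blast
  show ?thesis
  proof (cases "bloch_radius f")
    case (real x)
    then show ?thesis using lower[of "x + 1"] by (simp add: ennreal_le_iff)
  qed simp
qed

theorem theorem3p1:
  fixes p q :: complex
  assumes "p \<in> closure unit_disk - {0}" and "q \<in> closure unit_disk - {0}" and "p \<noteq> q"
  shows "bloch_constant p q = \<infinity>"
proof -
  have p: "p \<noteq> 0" "norm p \<le> 1" using assms(1) by auto
  have "bloch_radius f = \<infinity>" if "f \<in> M1 p q" for f
    using that unfolding M1_def by (intro bloch_radius_infinite[OF p]) auto
  then show ?thesis by (simp add: bloch_constant_def infinity_ennreal_def)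
qed

end
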